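(* Let $n \geq 12$ be an even integer. Let $G_n$ be the graph with vertices $v_1,\ldots,v_n$ and the following edges: the edges of the cycle $v_1v_2\cdots v_nv_1$; the edges $v_n v_{\frac n2-1}$, $v_1v_{n-2}$ and $v_{n-1}v_{n-3}$; and the edges $v_kv_{n-2-k}$ for every integer $k$ with $2\le k\le \frac n2-2$. Let $H_n$ be the graph obtained from $G_n$ by adding the following edges, where indices are read modulo $n$ with representatives in $\{1,\ldots,n\}$ (so $v_0=v_n$, $v_{-1}=v_{n-1}$, etc.): (a) if $n\equiv 0 \pmod 4$: the edge $v_{\frac n4}v_{\frac{3n}4}$ and the edges $v_{\frac n4+i}\,v_{\frac n4-i}$ for $1\le i\le \frac n2-1$; (b) if $n\equiv 2\pmod 4$: the edge $v_1v_{\frac n2+1}$ and the edges $v_{1+i}\,v_{1-i}$ for $1\le i\le \frac n2-1$. Then $H_n$ is a quartic (4-regular) Hamiltonian graph, and $H_n$ is asymmetric.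
   Context: Graphs are undirected, without loops or multiple edges. A graph is asymmetric if its automorphism group (acting on vertices) is trivial. *)

theory Defs
  imports "HOL-Combinatorics.Permutations" "Graph_Theory.Graph_Theory"
begin

text \<open>
  A finite undirected graph without loops or multiple edges is an instance of the locale
  \<^locale>\<open>graph\<close>: a symmetric loop-free digraph without parallel arcs, each undirected edge
  being a pair of opposite arcs. Hence the degree of a vertex is its out-degree.
\<close>

definition regular_graph :: "nat \<Rightarrow> ('a, 'b) pre_digraph \<Rightarrow> bool" where
  "regular_graph d G \<longleftrightarrow> graph G \<and> (\<forall>v \<in> verts G. out_degree G v = d)"

text \<open>
  The bound on the length rules out the closed walk that traverses one edge back and forth,
  which is a cycle in the sense of \<^const>\<open>pre_digraph.cycle\<close>.
\<close>

definition hamiltonian :: "('a, 'b) pre_digraph \<Rightarrow> bool" where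
  "hamiltonian G \<longleftrightarrow>
     (\<exists>p. pre_digraph.cycle G p \<and> 3 \<le> length p \<and> tail G ` set p = verts G)"

text \<open>
  Automorphisms act on vertices; since \<open>permutes\<close> fixes everything outside the vertex set,
  each of them is represented by exactly one function.
\<close>

definition automorphisms :: "('a, 'b) pre_digraph \<Rightarrow> ('a \<Rightarrow> 'a) set" where
  "automorphisms G =
     {f. f permutes verts G \<and>
         (\<forall>u \<in> verts G. \<forall>v \<in> verts G.
            (u, v) \<in> arcs_ends G \<longleftrightarrow> (f u, f v) \<in> arcs_ends G)}"

definition asymmetric :: "('a, 'b) pre_digraph \<Rightarrow> bool" where
  "asymmetric G \<longleftrightarrow> automorphisms G = {id}"

definition edge_arcs :: "'a set set \<Rightarrow> ('a \<times> 'a) set" where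
  "edge_arcs E = {(u, v). {u, v} \<in> E}"

text \<open>
  The vertex \<open>v\<^sub>i\<close> is the integer \<open>i\<close> with \<open>1 \<le> i \<le> n\<close>; \<open>idx n\<close> maps an arbitrary index to
  its representative modulo \<open>n\<close> in that range.
\<close>

definition idx :: "int \<Rightarrow> int \<Rightarrow> int" where
  "idx n i = (i - 1) mod n + 1"

definition Gn :: "int \<Rightarrow> int pair_pre_digraph" where
  "Gn n = \<lparr>
     pverts = {1..n},
     parcs = edge_arcs (
       {{i, i + 1} | i. 1 \<le> i \<and> i \<le> n - 1} \<union> {{n, 1}} \<union>
       {{n, n div 2 - 1}, {1, n - 2}, {n - 1, n - 3}} \<union>
       {{k, n - 2 - k} | k. 2 \<le> k \<and> k \<le> n div 2 - 2})\<rparr>"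

definition added_edges :: "int \<Rightarrow> int set set" where
  "added_edges n =
     (if n mod 4 = 0
      then {{n div 4, 3 * n div 4}} \<union>
           {{idx n (n div 4 + i), idx n (n div 4 - i)} | i. 1 \<le> i \<and> i \<le> n div 2 - 1}
      else {{1, n div 2 + 1}} \<union>
           {{idx n (1 + i), idx n (1 - i)} | i. 1 \<le> i \<and> i \<le> n div 2 - 1})"

definition Hn :: "int \<Rightarrow> int pair_pre_digraph" where
  "Hn n = (Gn n)\<lparr>parcs := parcs (Gn n) \<union> edge_arcs (added_edges n)\<rparr>"

end

(* H_n has only six triangles (4 | n) or four (otherwise), and their mutual position singles out
   one vertex: n/2 - 1 is the only one on two edges that each lie in two triangles if 4 | n, and
   n/2 is the only one in two triangles otherwise. Starting there, the incidences between triangles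
   show that an automorphism fixes all vertices near n (and near n/2 if 4 | n). From those,
   fixedness spreads to the whole graph: if all neighbours of a fixed vertex but one are fixed, so
   is the last one, and likewise for the common neighbours of two fixed vertices. *)

theory Submission
  imports Defs
begin

text \<open>The chords come from two reflections of the cycle: \<open>i -> n - 2 - i\<close> in
  \<open>Gn\<close>, and \<open>i -> 2c - i\<close> in the added edges, with \<open>c = n/4\<close>
  or \<open>c = 1\<close>. Each fixes two opposite vertices, which need other edges:
  \<open>c\<close> is joined to \<open>c + n/2\<close>; for the first reflection, the fixed vertices
  \<open>n/2 - 1\<close>, \<open>n - 1\<close> and the pairs \<open>n\<close>, \<open>n - 2\<close>
  and \<open>1\<close>, \<open>n - 3\<close> are rewired by three special edges. Elsewhere the
  neighbours of \<open>x\<close> are \<open>x - 1\<close>, \<open>x + 1\<close> and its two images,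
  so a triangle has to involve a fixed vertex of a reflection or a special edge. The composition of
  the reflections decides how fixedness can travel. If 4 | n it rotates by \<open>n/2 + 2\<close> or
  its inverse, so that vertices near \<open>n\<close> have neighbours near \<open>n/2\<close> and
  both regions must grow together. Otherwise it rotates by 4, and one block around \<open>n\<close>
  is enough. The smallest case \<open>n = 12\<close> is peculiar: there \<open>3n/4\<close>
  coincides with \<open>n - 3\<close>, which changes a neighbourhood and creates one more edge in
  two triangles.\<close>

section \<open>Adjacency as linear arithmetic\<close>

text \<open>
  Upward adjacency in \<^term>\<open>Hn n\<close> for \<open>n = 4q\<close> (\<open>up0\<close>) and for \<open>n = 4q + 2\<close> (\<open>up2\<close>). Writing
  the order through \<open>q\<close> keeps every incidence linear, without division or parity conditions. In
  the names of facts below, \<open>m\<close> is \<open>n div 2\<close> and a digit after \<open>m\<close> or \<open>n\<close> is subtracted.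
\<close>

definition up0 :: "int \<Rightarrow> int \<Rightarrow> int \<Rightarrow> bool" where
  "up0 q x y \<longleftrightarrow> 1 \<le> x \<and> x < y \<and> y \<le> 4 * q \<and>
     (y = x + 1 \<or> x = 1 \<and> y = 4 * q \<or> x = 2 * q - 1 \<and> y = 4 * q \<or> x = 1 \<and> y = 4 * q - 2 \<or>
      x = 4 * q - 3 \<and> y = 4 * q - 1 \<or> 2 \<le> x \<and> x + y = 4 * q - 2 \<or>
      x = q \<and> y = 3 * q \<or> x + y = 2 * q \<or> x + y = 6 * q)"

definition up2 :: "int \<Rightarrow> int \<Rightarrow> int \<Rightarrow> bool" where
  "up2 q x y \<longleftrightarrow> 1 \<le> x \<and> x < y \<and> y \<le> 4 * q + 2 \<and>
     (y = x + 1 \<or> x = 1 \<and> y = 4 * q + 2 \<or> x = 2 * q \<and> y = 4 * q + 2 \<or> x = 1 \<and> y = 4 * q \<or>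
      x = 4 * q - 1 \<and> y = 4 * q + 1 \<or> 2 \<le> x \<and> x + y = 4 * q \<or>
      x = 1 \<and> y = 2 * q + 2 \<or> x + y = 4 * q + 4)"

definition adj0 :: "int \<Rightarrow> int \<Rightarrow> int \<Rightarrow> bool" where
  "adj0 q x y \<longleftrightarrow> up0 q x y \<or> up0 q y x"

definition adj2 :: "int \<Rightarrow> int \<Rightarrow> int \<Rightarrow> bool" where
  "adj2 q x y \<longleftrightarrow> up2 q x y \<or> up2 q y x"

section \<open>From edge sets to linear conditions on indices\<close>

lemma idx_in_range: "1 \<le> i \<Longrightarrow> i \<le> n \<Longrightarrow> idx n i = i"
  by (simp add: idx_def)

lemma idx_nonpos: "1 - n \<le> i \<Longrightarrow> i \<le> 0 \<Longrightarrow> idx n i = i + n"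
proof -
  assume "1 - n \<le> i" "i \<le> 0"
  then have "(i - 1 + n) mod n = i - 1 + n" by (intro mod_pos_pos_trivial) auto
  then show ?thesis by (simp add: idx_def)
qed

text \<open>As \<open>c \<le> m\<close> and \<open>i < m\<close>, the index \<open>c + i\<close>
  never wraps around, whereas \<open>c - i\<close> does exactly when \<open>i \<ge> c\<close>; hence
  the two sums. Both \<open>c = q\<close>, \<open>m = 2q\<close> and \<open>c = 1\<close>,
  \<open>m = 2q + 1\<close> are covered.\<close>

lemma mirror_edges:
  assumes "1 \<le> c" "c \<le> m"
  shows "{u, v} \<in> {{idx (2 * m) (c + i), idx (2 * m) (c - i)} | i. 1 \<le> i \<and> i \<le> m - 1} \<longleftrightarrow>
    u \<in> {1..2 * m} \<and> v \<in> {1..2 * m} \<and> u \<noteq> v \<and> (u + v = 2 * c \<or> u + v = 2 * c + 2 * m)"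
    (is "_ \<in> {?e i | i. ?P i} \<longleftrightarrow> ?R")
proof
  assume "{u, v} \<in> {?e i | i. ?P i}"
  then obtain i where i: "?P i" "{u, v} = {idx (2 * m) (c + i), idx (2 * m) (c - i)}" by blast
  from i(1) assms have "idx (2 * m) (c + i) = c + i" by (intro idx_in_range) linarith+
  moreover have "idx (2 * m) (c - i) = (if i < c then c - i else c - i + 2 * m)"
    using i(1) assms by (auto simp: idx_in_range idx_nonpos)
  ultimately show ?R using i assms unfolding doubleton_eq_iff
    by (auto split: if_splits)
next
  have *: "{x, y} \<in> {?e i | i. ?P i}"
    if "x < y" "1 \<le> x" "y \<le> 2 * m" "x + y = 2 * c \<or> x + y = 2 * c + 2 * m" for x y
  proof (cases "x + y = 2 * c")
    case True
    have "idx (2 * m) (c + (y - c)) = y" "idx (2 * m) (c - (y - c)) = x"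
      using that True by (auto simp: idx_def)
    moreover have "?P (y - c)" using that True assms by linarith
    ultimately have "{x, y} = ?e (y - c) \<and> ?P (y - c)" by (simp only: insert_commute[of x y])
    then show ?thesis by blast
  next
    case False
    \<comment> \<open>Now the smaller vertex \<open>x\<close> is \<open>c + i\<close>: since
      \<open>y\<close> exceeds \<open>c + m\<close>, the value \<open>y - c\<close> would be too
      large for \<open>i\<close>.\<close>
    then have xy: "c - (x - c) = y - 2 * m" using that by simp
    have "idx (2 * m) (c + (x - c)) = x"
      using that by (auto simp: idx_def)
    moreover have "idx (2 * m) (c - (x - c)) = y"
      unfolding xy using that idx_nonpos[of "2 * m" "y - 2 * m"] by simp
    moreover have "?P (x - c)" using that xy assms by linarith
    ultimately have "{x, y} = ?e (x - c) \<and> ?P (x - c)" by simp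
    then show ?thesis by blast
  qed
  assume r: ?R
  then consider "u < v" | "v < u" by (auto simp: linorder_neq_iff)
  then show "{u, v} \<in> {?e i | i. ?P i}"
  proof cases
    case 1
    then show ?thesis using * r by simp
  next
    case 2
    then have "{v, u} \<in> {?e i | i. ?P i}"
      using * r by (simp add: add.commute)
    then show ?thesis by (simp only: insert_commute[of v u])
  qed
qed

lemma cycle_edges:
  "{u, v} \<in> {{i, i + 1} | i. 1 \<le> i \<and> i \<le> n - 1} \<longleftrightarrow>
    1 \<le> u \<and> u \<le> n \<and> 1 \<le> v \<and> v \<le> n \<and> (v = u + 1 \<or> u = v + (1::int))"
  (is "?L \<longleftrightarrow> ?R")
proof
  assume ?L
  then show ?R by (auto simp: doubleton_eq_iff)
next
  assume ?R
  then consider "{u, v} = {u, u + 1}" "1 \<le> u" "u \<le> n - 1"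
    | "{u, v} = {v, v + 1}" "1 \<le> v" "v \<le> n - 1"
    by (elim conjE disjE) (simp_all add: doubleton_eq_iff)
  then show ?L by cases blast+
qed

lemma cross_edges:
  "{u, v} \<in> {{k, 2 * m - 2 - k} | k. 2 \<le> k \<and> k \<le> m - 2} \<longleftrightarrow>
    2 \<le> u \<and> 2 \<le> v \<and> u \<noteq> v \<and> u + v = 2 * m - (2::int)"
  (is "?L \<longleftrightarrow> ?R")
proof
  assume ?L
  then show ?R by (auto simp: doubleton_eq_iff)
next
  assume ?R
  then consider "{u, v} = {u, 2 * m - 2 - u}" "2 \<le> u" "u \<le> m - 2"
    | "{u, v} = {v, 2 * m - 2 - v}" "2 \<le> v" "v \<le> m - 2"
    by (cases "u < v") (auto simp: doubleton_eq_iff)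
  then show ?L by cases blast+
qed

lemma arcs_Gn:
  "(u, v) \<in> parcs (Gn (2 * m)) \<longleftrightarrow>
    1 \<le> u \<and> u \<le> 2 * m \<and> 1 \<le> v \<and> v \<le> 2 * m \<and> (v = u + 1 \<or> u = v + 1) \<or>
    {u, v} \<in> {{2 * m, 1}, {2 * m, m - 1}, {1, 2 * m - 2}, {2 * m - 1, 2 * m - 3}} \<or>
    2 \<le> u \<and> 2 \<le> v \<and> u \<noteq> v \<and> u + v = 2 * m - 2"
proof -
  have d: "2 * m div 2 = m" by simp
  have "parcs (Gn (2 * m)) = edge_arcs (
       {{i, i + 1} | i. 1 \<le> i \<and> i \<le> 2 * m - 1} \<union> {{2 * m, 1}} \<union>
       {{2 * m, m - 1}, {1, 2 * m - 2}, {2 * m - 1, 2 * m - 3}} \<union>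
       {{k, 2 * m - 2 - k} | k. 2 \<le> k \<and> k \<le> m - 2})"
    unfolding Gn_def d by simp
  then show ?thesis
    by (simp only: edge_arcs_def Un_iff prod.case cycle_edges cross_edges insert_iff empty_iff
        mem_Collect_eq[of "(u, v)"]) argo
qed

lemma arcs_Hn0:
  assumes "3 \<le> q"
  shows "(u, v) \<in> parcs (Hn (4 * q)) \<longleftrightarrow> adj0 q u v"
proof -
  have d: "4 * q div 2 = 2 * q" "4 * q div 4 = q" "3 * (4 * q) div 4 = 3 * q" "2 * (2 * q) = 4 * q" by auto
  have m: "{u, v} \<in> {{idx (4 * q) (q + i), idx (4 * q) (q - i)} | i. 1 \<le> i \<and> i \<le> 2 * q - 1} \<longleftrightarrow>
    u \<in> {1..4 * q} \<and> v \<in> {1..4 * q} \<and> u \<noteq> v \<and> (u + v = 2 * q \<or> u + v = 6 * q)" for u v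
    using mirror_edges[of q "2 * q" u v] assms by simp
  have e: "(u, v) \<in> edge_arcs (added_edges (4 * q)) \<longleftrightarrow> {u, v} = {q, 3 * q} \<or>
    u \<in> {1..4 * q} \<and> v \<in> {1..4 * q} \<and> u \<noteq> v \<and> (u + v = 2 * q \<or> u + v = 6 * q)" for u v
    unfolding m[symmetric] added_edges_def d edge_arcs_def
    by (simp only: mod_mult_self1_is_0 if_True Un_iff insert_iff empty_iff prod.case
        mem_Collect_eq[of "(u, v)"]) simp
  have r: "(u, v) \<in> parcs (Hn (4 * q)) \<longleftrightarrow>
     (u, v) \<in> parcs (Gn (2 * (2 * q))) \<or> (u, v) \<in> edge_arcs (added_edges (4 * q))" for u v
    unfolding Hn_def by simp
  have asc: "(u, v) \<in> parcs (Hn (4 * q)) \<longleftrightarrow> up0 q u v" if "u < v" for u v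
  proof
    assume "(u, v) \<in> parcs (Hn (4 * q))"
    then show "up0 q u v"
      using assms that unfolding r arcs_Gn e insert_iff empty_iff doubleton_eq_iff atLeastAtMost_iff up0_def
      by (elim disjE conjE; simp)
  next
    assume "up0 q u v"
    then show "(u, v) \<in> parcs (Hn (4 * q))"
      using assms that unfolding r arcs_Gn e insert_iff empty_iff doubleton_eq_iff atLeastAtMost_iff up0_def
      by (elim disjE conjE; simp)
  qed
  have sym: "(u, v) \<in> parcs (Hn (4 * q)) \<longleftrightarrow> (v, u) \<in> parcs (Hn (4 * q))"
    by (simp add: Hn_def Gn_def edge_arcs_def insert_commute)
  have "(u, u) \<notin> parcs (Hn (4 * q))"
    using assms unfolding r arcs_Gn e insert_iff empty_iff doubleton_eq_iff
    by (intro notI; elim disjE conjE; simp)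
  then show ?thesis
    using asc[of u v] asc[of v u] sym unfolding adj0_def
    by (cases u v rule: linorder_cases) (auto simp: up0_def)
qed

lemma arcs_Hn2:
  assumes "3 \<le> q"
  shows "(u, v) \<in> parcs (Hn (4 * q + 2)) \<longleftrightarrow> adj2 q u v"
proof -
  have d: "(4 * q + 2) div 2 + 1 = 2 * q + 2" "(4 * q + 2) div 2 - 1 = 2 * q"
    "2 * (2 * q + 1) = 4 * q + 2" by auto
  have m: "{u, v} \<in> {{idx (4 * q + 2) (1 + i), idx (4 * q + 2) (1 - i)} | i. 1 \<le> i \<and> i \<le> 2 * q} \<longleftrightarrow>
    u \<in> {1..4 * q + 2} \<and> v \<in> {1..4 * q + 2} \<and> u \<noteq> v \<and> (u + v = 2 \<or> u + v = 4 * q + 4)" for u v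
    using mirror_edges[of 1 "2 * q + 1" u v] assms by (simp add: add.commute)
  have "(4 * q + 2) mod 4 \<noteq> 0" by presburger
  then have e: "(u, v) \<in> edge_arcs (added_edges (4 * q + 2)) \<longleftrightarrow> {u, v} = {1, 2 * q + 2} \<or>
    u \<in> {1..4 * q + 2} \<and> v \<in> {1..4 * q + 2} \<and> u \<noteq> v \<and> (u + v = 2 \<or> u + v = 4 * q + 4)" for u v
    unfolding m[symmetric] added_edges_def edge_arcs_def d
    by (simp only: if_False Un_iff insert_iff empty_iff prod.case
        mem_Collect_eq[of "(u, v)"]) simp
  have r: "(u, v) \<in> parcs (Hn (4 * q + 2)) \<longleftrightarrow>
     (u, v) \<in> parcs (Gn (2 * (2 * q + 1))) \<or> (u, v) \<in> edge_arcs (added_edges (4 * q + 2))" for u v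
    unfolding Hn_def d by simp
  have asc: "(u, v) \<in> parcs (Hn (4 * q + 2)) \<longleftrightarrow> up2 q u v" if "u < v" for u v
  proof
    assume "(u, v) \<in> parcs (Hn (4 * q + 2))"
    then show "up2 q u v"
      using assms that unfolding r arcs_Gn e insert_iff empty_iff doubleton_eq_iff atLeastAtMost_iff up2_def
      by (elim disjE conjE; simp)
  next
    assume "up2 q u v"
    then show "(u, v) \<in> parcs (Hn (4 * q + 2))"
      using assms that unfolding r arcs_Gn e insert_iff empty_iff doubleton_eq_iff atLeastAtMost_iff up2_def
      by (elim disjE conjE; simp)
  qed
  have sym: "(u, v) \<in> parcs (Hn (4 * q + 2)) \<longleftrightarrow> (v, u) \<in> parcs (Hn (4 * q + 2))"
    by (simp add: Hn_def Gn_def edge_arcs_def insert_commute)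
  have "(u, u) \<notin> parcs (Hn (4 * q + 2))"
    using assms unfolding r arcs_Gn e insert_iff empty_iff doubleton_eq_iff
    by (intro notI; elim disjE conjE; simp)
  then show ?thesis
    using asc[of u v] asc[of v u] sym unfolding adj2_def
    by (cases u v rule: linorder_cases) (auto simp: up2_def)
qed

lemma adj2_sym: "adj2 q x y \<longleftrightarrow> adj2 q y x"
  by (auto simp: adj2_def)

lemma adj0_irrefl: "\<not> adj0 q x x"
  by (simp add: adj0_def up0_def)

section \<open>Neighbourhoods for n = 4q\<close>

lemma nbrs0_1:
  assumes "3 \<le> q"
  shows "adj0 q 1 y \<longleftrightarrow> y = 2 \<or> y = 2 * q - 1 \<or> y = 4 * q - 2 \<or> y = 4 * q"
  using assms unfolding adj0_def up0_def
  by (intro iffI; elim disjE conjE; ((simp; fail) | linarith | (simp; linarith)))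

text \<open>General position: the last two neighbours are the images under the two reflections. The
  second reflection fixes \<open>q\<close>, which is therefore excluded.\<close>

lemma nbrs0_low:
  assumes "3 \<le> q" "2 \<le> x" "x \<le> 2 * q - 2" "x \<noteq> q"
  shows "adj0 q x y \<longleftrightarrow> y = x - 1 \<or> y = x + 1 \<or> y = 4 * q - 2 - x \<or> y = 2 * q - x"
  using assms unfolding adj0_def up0_def
  by (intro iffI; elim disjE conjE; ((simp; fail) | linarith | (simp; linarith)))

lemma nbrs0_q:
  assumes "3 \<le> q"
  shows "adj0 q q y \<longleftrightarrow> y = q - 1 \<or> y = q + 1 \<or> y = 3 * q - 2 \<or> y = 3 * q"
  using assms unfolding adj0_def up0_def
  by (intro iffI; elim disjE conjE; ((simp; fail) | linarith | (simp; linarith)))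

lemma nbrs0_m1:
  assumes "3 \<le> q"
  shows "adj0 q (2 * q - 1) y \<longleftrightarrow> y = 1 \<or> y = 2 * q - 2 \<or> y = 2 * q \<or> y = 4 * q"
  using assms unfolding adj0_def up0_def
  by (intro iffI; elim disjE conjE; ((simp; fail) | linarith | (simp; linarith)))

lemma nbrs0_high:
  assumes "3 \<le> q" "2 * q \<le> x" "x \<le> 4 * q - 4" "x \<noteq> 3 * q"
  shows "adj0 q x y \<longleftrightarrow> y = x - 1 \<or> y = x + 1 \<or> y = 4 * q - 2 - x \<or> y = 6 * q - x"
  using assms unfolding adj0_def up0_def
  by (intro iffI; elim disjE conjE; ((simp; fail) | linarith | (simp; linarith)))

text \<open>For \<open>q = 3\<close> the vertex \<open>3q\<close> is \<open>4q - 3\<close>, which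
  has the neighbour \<open>4q - 1\<close> in place of \<open>q - 2\<close>.\<close>

lemma nbrs0_3q:
  assumes "4 \<le> q"
  shows "adj0 q (3 * q) y \<longleftrightarrow> y = 3 * q - 1 \<or> y = 3 * q + 1 \<or> y = q - 2 \<or> y = q"
  using assms unfolding adj0_def up0_def
  by (intro iffI; elim disjE conjE; ((simp; fail) | linarith | (simp; linarith)))

text \<open>The mirror image of \<open>4q - 3\<close> is \<open>2q + 3\<close>, except for
  \<open>q = 3\<close>: then \<open>4q - 3 = 3q\<close> lies on the axis and is joined to
  \<open>q\<close> instead.\<close>

lemma nbrs0_n3:
  assumes "3 \<le> q" "x = 4 * q - 3"
  shows "adj0 q x y \<longleftrightarrow> y = 4 * q - 4 \<or> y = 4 * q - 2 \<or> y = 4 * q - 1 \<or> y = (if q = 3 then 3 else 2 * q + 3)"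
  using assms unfolding adj0_def up0_def
  by (intro iffI; elim disjE conjE; ((simp; fail) | linarith | (simp; linarith)))

lemma nbrs0_n2:
  assumes "3 \<le> q"
  shows "adj0 q (4 * q - 2) y \<longleftrightarrow> y = 1 \<or> y = 4 * q - 3 \<or> y = 4 * q - 1 \<or> y = 2 * q + 2"
  using assms unfolding adj0_def up0_def
  by (intro iffI; elim disjE conjE; ((simp; fail) | linarith | (simp; linarith)))

lemma nbrs0_n1:
  assumes "3 \<le> q"
  shows "adj0 q (4 * q - 1) y \<longleftrightarrow> y = 4 * q - 3 \<or> y = 4 * q - 2 \<or> y = 4 * q \<or> y = 2 * q + 1"
  using assms unfolding adj0_def up0_def
  by (intro iffI; elim disjE conjE; ((simp; fail) | linarith | (simp; linarith)))

lemma nbrs0_n: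
  assumes "3 \<le> q"
  shows "adj0 q (4 * q) y \<longleftrightarrow> y = 4 * q - 1 \<or> y = 1 \<or> y = 2 * q - 1 \<or> y = 2 * q"
  using assms unfolding adj0_def up0_def
  by (intro iffI; elim disjE conjE; ((simp; fail) | linarith | (simp; linarith)))

section \<open>Neighbourhoods for n = 4q + 2\<close>

lemma nbrs2_1:
  assumes "3 \<le> q"
  shows "adj2 q 1 y \<longleftrightarrow> y = 2 \<or> y = 2 * q + 2 \<or> y = 4 * q \<or> y = 4 * q + 2"
  using assms unfolding adj2_def up2_def
  by (intro iffI; elim disjE conjE; ((simp; fail) | linarith | (simp; linarith)))

lemma nbrs2_low:
  assumes "3 \<le> q" "2 \<le> x" "x \<le> 2 * q - 1"
  shows "adj2 q x y \<longleftrightarrow> y = x - 1 \<or> y = x + 1 \<or> y = 4 * q - x \<or> y = 4 * q + 4 - x"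
  using assms unfolding adj2_def up2_def
  by (intro iffI; elim disjE conjE; ((simp; fail) | linarith | (simp; linarith)))

lemma nbrs2_m1:
  assumes "3 \<le> q"
  shows "adj2 q (2 * q) y \<longleftrightarrow> y = 2 * q - 1 \<or> y = 2 * q + 1 \<or> y = 2 * q + 4 \<or> y = 4 * q + 2"
  using assms unfolding adj2_def up2_def
  by (intro iffI; elim disjE conjE; ((simp; fail) | linarith | (simp; linarith)))

lemma nbrs2_m:
  assumes "3 \<le> q"
  shows "adj2 q (2 * q + 1) y \<longleftrightarrow> y = 2 * q - 1 \<or> y = 2 * q \<or> y = 2 * q + 2 \<or> y = 2 * q + 3"
  using assms unfolding adj2_def up2_def
  by (intro iffI; elim disjE conjE; ((simp; fail) | linarith | (simp; linarith)))

lemma nbrs2_m_plus1: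
  assumes "3 \<le> q"
  shows "adj2 q (2 * q + 2) y \<longleftrightarrow> y = 1 \<or> y = 2 * q - 2 \<or> y = 2 * q + 1 \<or> y = 2 * q + 3"
  using assms unfolding adj2_def up2_def
  by (intro iffI; elim disjE conjE; ((simp; fail) | linarith | (simp; linarith)))

lemma nbrs2_high:
  assumes "3 \<le> q" "2 * q + 3 \<le> x" "x \<le> 4 * q - 2"
  shows "adj2 q x y \<longleftrightarrow> y = x - 1 \<or> y = x + 1 \<or> y = 4 * q - x \<or> y = 4 * q + 4 - x"
  using assms unfolding adj2_def up2_def
  by (intro iffI; elim disjE conjE; ((simp; fail) | linarith | (simp; linarith)))

lemma nbrs2_n3:
  assumes "3 \<le> q"
  shows "adj2 q (4 * q - 1) y \<longleftrightarrow> y = 5 \<or> y = 4 * q - 2 \<or> y = 4 * q \<or> y = 4 * q + 1"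
  using assms unfolding adj2_def up2_def
  by (intro iffI; elim disjE conjE; ((simp; fail) | linarith | (simp; linarith)))

lemma nbrs2_n2:
  assumes "3 \<le> q"
  shows "adj2 q (4 * q) y \<longleftrightarrow> y = 1 \<or> y = 4 \<or> y = 4 * q - 1 \<or> y = 4 * q + 1"
  using assms unfolding adj2_def up2_def
  by (intro iffI; elim disjE conjE; ((simp; fail) | linarith | (simp; linarith)))

lemma nbrs2_n1:
  assumes "3 \<le> q"
  shows "adj2 q (4 * q + 1) y \<longleftrightarrow> y = 3 \<or> y = 4 * q - 1 \<or> y = 4 * q \<or> y = 4 * q + 2"
  using assms unfolding adj2_def up2_def
  by (intro iffI; elim disjE conjE; ((simp; fail) | linarith | (simp; linarith)))

lemma nbrs2_n:
  assumes "3 \<le> q"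
  shows "adj2 q (4 * q + 2) y \<longleftrightarrow> y = 1 \<or> y = 2 \<or> y = 2 * q \<or> y = 4 * q + 1"
  using assms unfolding adj2_def up2_def
  by (intro iffI; elim disjE conjE; ((simp; fail) | linarith | (simp; linarith)))

section \<open>Triangles\<close>

text \<open>Of the eight orientations of a triangle, the two cyclic ones contradict
  \<open>less\<close> and the other six are linear orders. Triangles then need to be classified only
  along increasing triples.\<close>

lemma triangle_ordered:
  fixes x y z :: "'a::order"
  assumes less: "\<And>u v. U u v \<Longrightarrow> u < v"
    and "U x y \<or> U y x" "U y z \<or> U z y" "U x z \<or> U z x"
  shows "\<exists>a b c. U a b \<and> U b c \<and> U a c \<and> {x, y, z} = {a, b, c}"
proof -
  have "\<not> (U x y \<and> U y z \<and> U z x)" "\<not> (U y x \<and> U z y \<and> U x z)"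
    using less by (meson order.strict_trans less_asym)+
  then consider "U x y" "U y z" "U x z" | "U x z" "U z y" "U x y" | "U y x" "U x z" "U y z"
    | "U y z" "U z x" "U y x" | "U z x" "U x y" "U z y" | "U z y" "U y x" "U z x"
    using assms(2-) by blast
  then show ?thesis
  proof cases
    case 1
    then show ?thesis by (intro exI[of _ x] exI[of _ y] exI[of _ z]) auto
  next
    case 2
    then show ?thesis by (intro exI[of _ x] exI[of _ z] exI[of _ y]) auto
  next
    case 3
    then show ?thesis by (intro exI[of _ y] exI[of _ x] exI[of _ z]) auto
  next
    case 4
    then show ?thesis by (intro exI[of _ y] exI[of _ z] exI[of _ x]) auto
  next
    case 5
    then show ?thesis by (intro exI[of _ z] exI[of _ x] exI[of _ y]) auto
  next
    case 6
    then show ?thesis by (intro exI[of _ z] exI[of _ y] exI[of _ x]) auto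
  qed
qed

lemma up2_less: "up2 q x y \<Longrightarrow> x < y"
  by (simp add: up2_def)

lemma up0_less: "up0 q x y \<Longrightarrow> x < y"
  by (simp add: up0_def)

definition tri2 :: "int \<Rightarrow> int set set" where
  "tri2 q = {{1, 2, 4 * q + 2}, {2 * q - 1, 2 * q, 2 * q + 1},
    {2 * q + 1, 2 * q + 2, 2 * q + 3}, {4 * q - 1, 4 * q, 4 * q + 1}}"

text \<open>Each chord family is a matching, and chords of different families at one vertex end 4
  apart. So, special edges aside, a triangle has only one chord and consists of three consecutive
  vertices, around \<open>1\<close>, \<open>2q\<close> or \<open>2q + 2\<close>. The edge from
  \<open>4q - 1\<close> to \<open>4q + 1\<close> closes the fourth.\<close>

lemma triangles2:
  assumes "3 \<le> q" "adj2 q x y" "adj2 q y z" "adj2 q x z"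
  shows "{x, y, z} \<in> tri2 q"
proof -
  have "\<exists>a b c. up2 q a b \<and> up2 q b c \<and> up2 q a c \<and> {x, y, z} = {a, b, c}"
    using assms(2-4) unfolding adj2_def by (intro triangle_ordered up2_less)
  then obtain a b c where *: "up2 q a b \<and> up2 q b c \<and> up2 q a c \<and> {x, y, z} = {a, b, c}"
    by (elim exE)
  then have t: "up2 q a b" "up2 q b c" "up2 q a c" and e: "{x, y, z} = {a, b, c}" by simp_all
  have "a = 1 \<and> b = 2 \<and> c = 4 * q + 2 \<or> a = 2 * q - 1 \<and> b = 2 * q \<and> c = 2 * q + 1 \<or>
    a = 2 * q + 1 \<and> b = 2 * q + 2 \<and> c = 2 * q + 3 \<or> a = 4 * q - 1 \<and> b = 4 * q \<and> c = 4 * q + 1"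
    using t assms(1) unfolding up2_def by (smt (z3))
  then show ?thesis unfolding e tri2_def by (elim disjE conjE) (simp_all only: insert_iff simp_thms)
qed

definition tri0 :: "int \<Rightarrow> int set set" where
  "tri0 q = {{1, 2 * q - 1, 4 * q}, {2 * q - 1, 2 * q, 4 * q},
    {2 * q - 2, 2 * q - 1, 2 * q}, {q - 1, q, q + 1},
    {3 * q - 1, 3 * q, 3 * q + 1}, {4 * q - 3, 4 * q - 2, 4 * q - 1}}"

text \<open>As in \<open>triangles2\<close>, with ends now \<open>2q - 2\<close> or
  \<open>2q + 2\<close> apart: consecutive triples occur around \<open>q\<close>, \<open>3q\<close>,
  \<open>2q - 1\<close> and, by a special edge, around \<open>4q - 2\<close>. The other two
  triangles contain the special edge from \<open>2q - 1\<close> to \<open>4q\<close>, whose ends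
  have the common neighbours \<open>1\<close> and \<open>2q\<close>.\<close>

lemma triangles0:
  assumes "3 \<le> q" "adj0 q x y" "adj0 q y z" "adj0 q x z"
  shows "{x, y, z} \<in> tri0 q"
proof -
  have "\<exists>a b c. up0 q a b \<and> up0 q b c \<and> up0 q a c \<and> {x, y, z} = {a, b, c}"
    using assms(2-4) unfolding adj0_def by (intro triangle_ordered up0_less)
  then obtain a b c where *: "up0 q a b \<and> up0 q b c \<and> up0 q a c \<and> {x, y, z} = {a, b, c}"
    by (elim exE)
  then have t: "up0 q a b" "up0 q b c" "up0 q a c" and e: "{x, y, z} = {a, b, c}" by simp_all
  have "a = 1 \<and> b = 2 * q - 1 \<and> c = 4 * q \<or> a = 2 * q - 1 \<and> b = 2 * q \<and> c = 4 * q \<or>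
    a = 2 * q - 2 \<and> b = 2 * q - 1 \<and> c = 2 * q \<or> a = q - 1 \<and> b = q \<and> c = q + 1 \<or>
    a = 3 * q - 1 \<and> b = 3 * q \<and> c = 3 * q + 1 \<or> a = 4 * q - 3 \<and> b = 4 * q - 2 \<and> c = 4 * q - 1"
    using t assms(1) unfolding up0_def by (smt (z3))
  then show ?thesis unfolding e tri0_def by (elim disjE conjE) (simp_all only: insert_iff simp_thms)
qed

text \<open>The last alternative arises because the triangles around \<open>3q\<close> and
  \<open>4q - 2\<close> overlap in an edge when \<open>q = 3\<close>.\<close>

lemma tri0_common_edge:
  assumes "3 \<le> q" "s \<in> tri0 q" "t \<in> tri0 q" "s \<noteq> t" "x \<noteq> y" "x \<in> s" "x \<in> t" "y \<in> s" "y \<in> t"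
  shows "{x, y} = {2 * q - 1, 4 * q} \<or> {x, y} = {2 * q - 1, 2 * q} \<or> q = 3 \<and> {x, y} = {9, 10}"
  using assms unfolding tri0_def insert_iff[of s] insert_iff[of t] empty_iff
  by (elim disjE FalseE; hypsubst_thin; unfold insert_iff empty_iff doubleton_eq_iff; smt (z3))

lemma tri2_cases:
  assumes "t \<in> tri2 q"
  obtains "t = {1, 2, 4 * q + 2}" | "t = {2 * q - 1, 2 * q, 2 * q + 1}"
    | "t = {2 * q + 1, 2 * q + 2, 2 * q + 3}" | "t = {4 * q - 1, 4 * q, 4 * q + 1}"
  using assms unfolding tri2_def insert_iff[of t] empty_iff by (elim disjE FalseE)

lemma tri2_common_vertex:
  assumes "3 \<le> q" "s \<in> tri2 q" "t \<in> tri2 q" "s \<noteq> t" "x \<in> s" "x \<in> t"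
  shows "x = 2 * q + 1"
  using assms unfolding tri2_def insert_iff[of s] insert_iff[of t] empty_iff
  by (elim disjE FalseE; hypsubst_thin; unfold insert_iff empty_iff; smt (z3))

section \<open>Rigidity\<close>

text \<open>An edge in two triangles, phrased by adjacency alone so that automorphisms visibly
  preserve it.\<close>

definition diamond :: "(int \<Rightarrow> int \<Rightarrow> bool) \<Rightarrow> int \<Rightarrow> int \<Rightarrow> bool" where
  "diamond R x y \<longleftrightarrow> R x y \<and> (\<exists>a b. a \<noteq> b \<and> R x a \<and> R y a \<and> R x b \<and> R y b)"

lemma diamond_adj0:
  assumes "3 \<le> q" "diamond (adj0 q) x y"
  shows "{x, y} = {2 * q - 1, 4 * q} \<or> {x, y} = {2 * q - 1, 2 * q} \<or> q = 3 \<and> {x, y} = {9, 10}"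
proof -
  from assms(2) obtain a b where ab: "adj0 q x y" "a \<noteq> b" "adj0 q x a" "adj0 q y a" "adj0 q x b" "adj0 q y b"
    unfolding diamond_def by blast
  have ne: "x \<noteq> y" "a \<noteq> x" "a \<noteq> y" using ab adj0_irrefl by metis+
  have t: "{x, y, a} \<in> tri0 q" "{x, y, b} \<in> tri0 q"
    using triangles0 assms(1) ab by simp_all
  have "a \<notin> {x, y, b}" using ne ab(2) by simp
  then have "{x, y, a} \<noteq> {x, y, b}" by blast
  from tri0_common_edge[OF assms(1) t this ne(1)] show ?thesis by simp
qed

text \<open>No vertex set is carried along: an automorphism is the identity outside the graph, where
  the relations of interest have no pairs.\<close>

locale adj_automorphism =
  fixes R :: "int \<Rightarrow> int \<Rightarrow> bool" and f :: "int \<Rightarrow> int"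
  assumes bij: "bij f" and adj_iff: "R (f x) (f y) \<longleftrightarrow> R x y"
begin

lemma inj_iff: "f x = f y \<longleftrightarrow> x = y"
  using bij by (meson bij_is_inj injD)

lemma ex_preimage: "(\<exists>x. P (f x)) \<longleftrightarrow> (\<exists>x. P x)"
  using bij by (metis bij_pointE)

text \<open>\<open>f d\<close> is again a common neighbour of \<open>x\<close> and \<open>y\<close>;
  if it is one of the fixed ones, injectivity forces \<open>f d = d\<close>.\<close>

lemma fix_common:
  assumes "f x = x" "f y = y" "R x d" "R y d"
    and "\<And>z. R x z \<Longrightarrow> R y z \<Longrightarrow> z = d \<or> f z = z"
  shows "f d = d"
proof -
  have "R x (f d)" "R y (f d)"
    using adj_iff[of x d] adj_iff[of y d] assms(1-4) by simp_all
  then have "f d = d \<or> f (f d) = f d" by (rule assms(5))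
  then show ?thesis by (simp add: inj_iff)
qed

lemma fix_nbr:
  assumes "f x = x" "R x d" "\<And>z. R x z \<Longrightarrow> z = d \<or> f z = z"
  shows "f d = d"
  by (rule fix_common[of x x]) (use assms in blast)+

lemma diamond_image: "diamond R x y \<Longrightarrow> diamond R (f x) (f y)"
  unfolding diamond_def by (metis adj_iff inj_iff)

end

section \<open>Rigidity for n = 4q\<close>

lemma rigid0:
  assumes q: "3 \<le> q" and aut: "adj_automorphism (adj0 q) f" and x: "1 \<le> x" "x \<le> 4 * q"
  shows "f x = x"
proof -
  interpret adj_automorphism "adj0 q" f by (rule aut)
  have d1: "diamond (adj0 q) (2 * q - 1) (4 * q)"
    unfolding diamond_def using q
    by (intro conjI exI[of _ 1] exI[of _ "2 * q"]) (simp_all add: nbrs0_m1 nbrs0_n)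
  have d2: "diamond (adj0 q) (2 * q - 1) (2 * q)"
    unfolding diamond_def using q
    by (intro conjI exI[of _ "4 * q"] exI[of _ "2 * q - 2"]) (simp_all add: nbrs0_m1 nbrs0_high)
  note d' = d1[THEN diamond_image, THEN diamond_adj0[OF q], unfolded doubleton_eq_iff]
    d2[THEN diamond_image, THEN diamond_adj0[OF q], unfolded doubleton_eq_iff]
  have ne: "f (4 * q) \<noteq> f (2 * q)" using q by (simp add: inj_iff)
  \<comment> \<open>The two images are distinct diamond edges sharing \<open>f (2 * q - 1)\<close>.
    The extra edge \<open>{9, 10}\<close> at \<open>q = 3\<close> is disjoint from the other two, so
    only \<open>2 * q - 1\<close> can be shared.\<close>
  have m1: "f (2 * q - 1) = 2 * q - 1"
    using d' ne q by (smt (z3))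
  have nm: "f (4 * q) = 4 * q \<and> f (2 * q) = 2 * q \<or> f (4 * q) = 2 * q \<and> f (2 * q) = 4 * q"
    using d' ne m1 q by (smt (z3))
  \<comment> \<open>A swap would send \<open>4 * q - 1\<close> to the neighbour
    \<open>2 * q + 1\<close> of \<open>2 * q\<close>, but the former lies in a triangle and the
    latter in none.\<close>
  have n: "f (4 * q) = 4 * q"
  proof (rule ccontr)
    assume "f (4 * q) \<noteq> 4 * q"
    with nm have swap: "f (4 * q) = 2 * q" "f (2 * q) = 4 * q" by auto
    have "adj0 q (f (4 * q)) (f (4 * q - 1))"
      using q by (simp add: adj_iff nbrs0_n)
    then have "f (4 * q - 1) \<in> {2 * q - 1, 2 * q + 1, 4 * q, 2 * q - 2}"
      using q swap nbrs0_high[of q "2 * q"] by auto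
    moreover have "f (4 * q - 1) \<noteq> f (2 * q - 1)" "f (4 * q - 1) \<noteq> f (2 * q)"
      using q by (auto simp: inj_iff)
    moreover have "\<not> adj0 q (f (2 * q - 1)) (f (4 * q - 1))"
      using q by (auto simp: adj_iff nbrs0_m1)
    then have "f (4 * q - 1) \<noteq> 2 * q - 2" using q by (auto simp: m1 nbrs0_m1)
    ultimately have e: "f (4 * q - 1) = 2 * q + 1" using m1 swap by auto
    have "adj0 q (4 * q - 1) (4 * q - 2)" "adj0 q (4 * q - 1) (4 * q - 3)" "adj0 q (4 * q - 2) (4 * q - 3)"
      using q by (simp_all add: nbrs0_n1 nbrs0_n2)
    then have "{f (4 * q - 1), f (4 * q - 2), f (4 * q - 3)} \<in> tri0 q"
      using q by (intro triangles0) (simp_all only: adj_iff)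
    then have "\<exists>t \<in> tri0 q. 2 * q + 1 \<in> t" unfolding e by blast
    then show False using q unfolding tri0_def by auto
  qed
  with nm q have m: "f (2 * q) = 2 * q" by auto
  have a1: "f 1 = 1"
    by (rule fix_common[OF n m1]) (use q m in \<open>auto simp: nbrs0_n nbrs0_m1\<close>)
  have a_m2: "f (2 * q - 2) = 2 * q - 2"
    by (rule fix_nbr[OF m1]) (use q m n a1 in \<open>auto simp: nbrs0_m1\<close>)
  have b1: "f (4 * q - 1) = 4 * q - 1"
    by (rule fix_nbr[OF n]) (use q m m1 a1 in \<open>auto simp: nbrs0_n\<close>)
  have b_m1: "f (2 * q + 1) = 2 * q + 1"
    by (rule fix_nbr[OF m]) (use q m1 n a_m2 in \<open>auto simp: nbrs0_high\<close>)
  have a2: "f 2 = 2"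
    by (rule fix_common[OF a1 a_m2]) (use q m1 in \<open>auto simp: nbrs0_1 nbrs0_low[of q "2 * q - 2"]\<close>)
  have b2: "f (4 * q - 2) = 4 * q - 2"
    by (rule fix_nbr[OF a1]) (use q m1 n a2 in \<open>auto simp: nbrs0_1\<close>)
  have b3: "f (4 * q - 3) = 4 * q - 3"
    by (rule fix_nbr[OF b1]) (use q n b2 b_m1 in \<open>auto simp: nbrs0_n1\<close>)
  have a_m3: "f (2 * q - 3) = 2 * q - 3"
    by (rule fix_nbr[OF a_m2]) (use q m1 a2 m in \<open>auto simp: nbrs0_low\<close>)
  have b_m2: "f (2 * q + 2) = 2 * q + 2"
    by (rule fix_nbr[OF b_m1]) (use q m a_m3 b1 in \<open>auto simp: nbrs0_high\<close>)
  \<comment> \<open>Fixedness spreads from \<open>n\<close> and \<open>2q\<close> to the mirror axis through \<open>q\<close> and \<open>3q\<close>.\<close>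
  define fixes_to where
    "fixes_to k \<longleftrightarrow> (\<forall>x. (1 \<le> x \<and> x \<le> k \<or> 2 * q - k \<le> x \<and> x \<le> 2 * q + k \<or>
      4 * q - k \<le> x \<and> x \<le> 4 * q) \<longrightarrow> f x = x)" for k
  have two: "fixes_to 2"
    unfolding fixes_to_def
  proof (intro allI impI)
    fix x
    assume "1 \<le> x \<and> x \<le> 2 \<or> 2 * q - 2 \<le> x \<and> x \<le> 2 * q + 2 \<or> 4 * q - 2 \<le> x \<and> x \<le> 4 * q"
    then have "x \<in> {1, 2, 2 * q - 2, 2 * q - 1, 2 * q, 2 * q + 1, 2 * q + 2, 4 * q - 2, 4 * q - 1, 4 * q}"
      by auto
    then show "f x = x" using a1 a2 a_m2 m1 m b_m1 b_m2 b2 b1 n by auto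
  qed
  have step: "fixes_to (k + 1)" if "fixes_to k" and k: "2 \<le> k" "k < q" for k
  proof -
    have F: "f x = x" if "1 \<le> x \<and> x \<le> k \<or> 2 * q - k \<le> x \<and> x \<le> 2 * q + k \<or> 4 * q - k \<le> x \<and> x \<le> 4 * q" for x
      using \<open>fixes_to k\<close> that unfolding fixes_to_def by blast
    have am: "f (2 * q - k - 1) = 2 * q - k - 1"
      by (rule fix_nbr[of "2 * q - k"]) (use q k F in \<open>auto simp: nbrs0_low\<close>)
    have b: "f (4 * q - k - 1) = 4 * q - k - 1"
    proof -
      \<comment> \<open>\<open>4 * q - k\<close> is in the range of \<open>nbrs0_high\<close> only
        from \<open>k = 4\<close> on; \<open>4 * q - 3\<close> was fixed in advance for
        \<open>k = 2\<close>.\<close>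
      consider "k = 2" | "k = 3" "q \<noteq> 3" | "4 \<le> k" using k by linarith
      then show ?thesis
      proof cases
        case 1
        then show ?thesis using b3 by simp
      next
        case 2
        show ?thesis
          by (rule fix_nbr[of "4 * q - k"]) (use 2 q k F in \<open>auto simp: nbrs0_n3\<close>)
      next
        case 3
        show ?thesis
          by (rule fix_nbr[of "4 * q - k"]) (use 3 q k F in \<open>auto simp: nbrs0_high\<close>)
      qed
    qed
    \<comment> \<open>\<open>k\<close> has a second neighbour not yet known to be fixed,
      \<open>4 * q - 2 - k\<close>. It is not adjacent to the mirror image
      \<open>2 * q - k - 1\<close> of \<open>k + 1\<close>, so common neighbours decide; likewise
      for \<open>bm\<close>.\<close>
    have a: "f (k + 1) = k + 1" if "k + 1 < q"
      by (rule fix_common[of k "2 * q - k - 1"]) (use am that q k F in \<open>auto simp: nbrs0_low\<close>)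
    have bm: "f (2 * q + k + 1) = 2 * q + k + 1" if "k + 1 < q"
    proof (cases "k = 2")
      case True
      show ?thesis
        by (rule fix_common[of "2 * q + k" "4 * q - k - 1"]) (use True b that q k F in \<open>auto simp: nbrs0_high nbrs0_n3\<close>)
    next
      case False
      show ?thesis
        by (rule fix_common[of "2 * q + k" "4 * q - k - 1"]) (use False b that q k F in \<open>auto simp: nbrs0_high\<close>)
    qed
    \<comment> \<open>In the last step the fronts meet on the axis, at \<open>q\<close> and
      \<open>3 * q\<close>.\<close>
    have end_k: "k + 1 = 2 * q - k - 1 \<and> 2 * q + k + 1 = 4 * q - k - 1" if "\<not> k + 1 < q"
      using that k by linarith
    have "f x = x" if "x \<in> {k + 1, 2 * q - k - 1, 2 * q + k + 1, 4 * q - k - 1}" for x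
      using that a bm am b end_k by (cases "k + 1 < q") auto
    then show ?thesis
      unfolding fixes_to_def using F by (smt (verit) insertCI)
  qed
  have "fixes_to k" if "2 \<le> k" "k \<le> q" for k
    using that by (induction k rule: int_ge_induct) (use two step in auto)
  then have "fixes_to q" using q by simp
  then show ?thesis
    using x unfolding fixes_to_def by (cases "x \<le> q"; cases "x \<le> 3 * q") auto
qed

section \<open>Rigidity for n = 4q + 2\<close>

lemma rigid2:
  assumes q: "3 \<le> q" and aut: "adj_automorphism (adj2 q) f" and x: "1 \<le> x" "x \<le> 4 * q + 2"
  shows "f x = x"
proof -
  interpret adj_automorphism "adj2 q" f by (rule aut)
  let ?T1 = "{1, 2, 4 * q + 2}" and ?T2 = "{2 * q - 1, 2 * q, 2 * q + 1}"
  let ?T3 = "{2 * q + 1, 2 * q + 2, 2 * q + 3}" and ?T4 = "{4 * q - 1, 4 * q, 4 * q + 1}"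
  have tri: "f ` {x, y, z} \<in> tri2 q" if "adj2 q x y" "adj2 q y z" "adj2 q x z" for x y z
    using triangles2[OF q, of "f x" "f y" "f z"] that by (simp add: adj_iff)
  have T: "f ` ?T1 \<in> tri2 q" "f ` ?T2 \<in> tri2 q" "f ` ?T3 \<in> tri2 q" "f ` ?T4 \<in> tri2 q"
    by (rule tri; use q in \<open>simp add: nbrs2_1 nbrs2_low nbrs2_m1 nbrs2_m nbrs2_m_plus1 nbrs2_n1 nbrs2_n2 nbrs2_n3\<close>)+
  have img_eq: "f ` s = f ` t \<longleftrightarrow> s = t" for s t
    using bij by (simp add: inj_image_eq_iff bij_is_inj)
  have img_mem: "f y \<in> f ` t \<longleftrightarrow> y \<in> t" for y t
    using bij by (simp add: inj_image_mem_iff bij_is_inj)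
  have m: "f (2 * q + 1) = 2 * q + 1"
  proof (rule tri2_common_vertex[OF q T(2) T(3)])
    have "2 * q \<notin> ?T3" by simp
    then show "f ` ?T2 \<noteq> f ` ?T3" unfolding img_eq by blast
  qed auto
  have T14: "f ` t = ?T1 \<or> f ` t = ?T4" if "f ` t \<in> tri2 q" "2 * q + 1 \<notin> t" for t
  proof -
    have "2 * q + 1 \<notin> f ` t" using that(2) img_mem[of "2 * q + 1" t] m by simp
    with that(1) show ?thesis by (cases rule: tri2_cases) auto
  qed
  \<comment> \<open>An invariant separating \<open>?T1\<close> from \<open>?T4\<close>: it holds at
    two vertices of the first, but in the second at most at \<open>4 * q - 1\<close> (where it does
    hold for \<open>q = 3\<close>). Within \<open>?T1\<close> it singles out
    \<open>2\<close>.\<close>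
  define C where "C z \<longleftrightarrow> (\<exists>k. adj2 q (2 * q + 1) k \<and> adj2 q z k)" for z
  have C_iff: "C (f z) \<longleftrightarrow> C z" for z
    unfolding C_def using ex_preimage[of "\<lambda>k. adj2 q (2 * q + 1) k \<and> adj2 q (f z) k"]
      adj_iff[of "2 * q + 1"] adj_iff[of z] m by simp
  have C: "C 1" "C (4 * q + 2)" "\<not> C 2" "\<not> C (4 * q)" "\<not> C (4 * q + 1)"
    using q unfolding C_def by (auto simp: nbrs2_1 nbrs2_n nbrs2_n1 nbrs2_n2 nbrs2_m nbrs2_low) presburger+
  have T1: "f ` ?T1 = ?T1"
  proof (rule ccontr)
    assume "f ` ?T1 \<noteq> ?T1"
    with T14[OF T(1)] q have "f ` ?T1 = ?T4" by simp
    then have "f 1 \<in> ?T4" "f (4 * q + 2) \<in> ?T4" by auto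
    with C C_iff have "f 1 = 4 * q - 1" "f (4 * q + 2) = 4 * q - 1" by (metis insertE empty_iff)+
    then show False using q inj_iff[of 1 "4 * q + 2"] by simp
  qed
  have T1_iff: "f y \<in> ?T1 \<longleftrightarrow> y \<in> ?T1" for y
    using img_mem[of y ?T1] unfolding T1 .
  have a2: "f 2 = 2"
  proof -
    have "2 \<in> f ` ?T1" unfolding T1 by simp
    then obtain y where y: "y \<in> ?T1" "2 = f y" by (rule imageE)
    then have "\<not> C y" using C_iff[of y] C(3) by simp
    then have "y = 2" using y(1) C(1,2) by auto
    with y(2) show ?thesis by simp
  qed
  have T4: "f ` ?T4 = ?T4"
  proof -
    have "4 * q \<notin> ?T1" using q by auto
    then have "?T4 \<noteq> ?T1" by blast
    then have "f ` ?T4 \<noteq> ?T1" using img_eq[of ?T4 ?T1] unfolding T1 by simp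
    with T14[OF T(4)] q show ?thesis by simp
  qed
  \<comment> \<open>\<open>4 * q - 1\<close> is the only vertex of \<open>?T4\<close> without a
    neighbour in \<open>?T1\<close>.\<close>
  have b3: "f (4 * q - 1) = 4 * q - 1"
  proof -
    have "\<not> adj2 q (f y) (4 * q - 1)" if "y \<in> ?T1" for y
      using that T1_iff[of y] q adj2_sym[of q "f y"] by (auto simp: nbrs2_n3)
    moreover have "adj2 q 1 (4 * q)" "adj2 q (4 * q + 2) (4 * q + 1)"
      using q by (simp_all add: nbrs2_1 nbrs2_n)
    then have "adj2 q (f 1) (f (4 * q))" "adj2 q (f (4 * q + 2)) (f (4 * q + 1))"
      unfolding adj_iff .
    ultimately have *: "f (4 * q) \<noteq> 4 * q - 1" "f (4 * q + 1) \<noteq> 4 * q - 1" by (metis insertCI)+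
    have "4 * q - 1 \<in> f ` ?T4" unfolding T4 by simp
    then obtain y where y: "y \<in> ?T4" "4 * q - 1 = f y" by (rule imageE)
    then have "y = 4 * q - 1" using * by auto
    with y(2) show ?thesis by simp
  qed
  have b4: "f (4 * q - 2) = 4 * q - 2"
  proof (rule fix_common[OF a2 b3])
    show "adj2 q 2 (4 * q - 2)" "adj2 q (4 * q - 1) (4 * q - 2)"
      using q by (simp_all add: nbrs2_low nbrs2_n3)
    fix z
    assume "adj2 q 2 z" "adj2 q (4 * q - 1) z"
    then show "z = 4 * q - 2 \<or> f z = z"
      using q nbrs2_low[of q 2 z] nbrs2_n3[of q z] by presburger
  qed
  \<comment> \<open>\<open>1\<close> and \<open>4 * q + 2\<close> are not yet known to be fixed, but
    invariance of the set \<open>?T1\<close> suffices to exclude them.\<close>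
  have a3: "f 3 = 3"
  proof -
    have "adj2 q (f 2) (f 3)" using q by (simp add: adj_iff nbrs2_low)
    then have "f 3 \<in> {1, 3, 4 * q - 2, 4 * q + 2}" using q by (auto simp: a2 nbrs2_low)
    moreover have "f 3 \<notin> ?T1" using T1_iff[of 3] q by simp
    moreover have "f 3 \<noteq> 4 * q - 2" using b4 inj_iff[of 3 "4 * q - 2"] q by auto
    ultimately show ?thesis by simp
  qed
  have b1: "f (4 * q + 1) = 4 * q + 1"
  proof (rule fix_common[OF a3 b3])
    show "adj2 q 3 (4 * q + 1)" "adj2 q (4 * q - 1) (4 * q + 1)"
      using q by (simp_all add: nbrs2_low nbrs2_n3)
    fix z
    assume "adj2 q 3 z" "adj2 q (4 * q - 1) z"
    then show "z = 4 * q + 1 \<or> f z = z"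
      using q nbrs2_low[of q 3 z] nbrs2_n3[of q z] by presburger
  qed
  have b0: "f (4 * q + 2) = 4 * q + 2"
    by (rule fix_common[OF b1 a2]) (use q a3 in \<open>auto simp: nbrs2_low nbrs2_n1\<close>)
  have a1: "f 1 = 1"
    by (rule fix_nbr[OF a2]) (use q a3 b0 b4 in \<open>auto simp: nbrs2_low add.commute\<close>)
  have b2: "f (4 * q) = 4 * q"
    by (rule fix_nbr[OF b1]) (use q a3 b0 b3 in \<open>auto simp: nbrs2_n1\<close>)
  have a4: "f 4 = 4"
    by (rule fix_nbr[OF b2]) (use q a1 b1 b3 in \<open>auto simp: nbrs2_n2\<close>)
  have a5: "f 5 = 5"
    by (rule fix_nbr[OF b3]) (use q b1 b2 b4 in \<open>auto simp: nbrs2_n3\<close>)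
  have b5: "f (4 * q - 3) = 4 * q - 3"
    by (rule fix_nbr[OF a3]) (use q a2 a4 b1 in \<open>auto simp: nbrs2_low add.commute\<close>)
  define fixes_to where
    "fixes_to k \<longleftrightarrow> (\<forall>x. (1 \<le> x \<and> x \<le> k \<or> 4 * q + 2 - k \<le> x \<and> x \<le> 4 * q + 2) \<longrightarrow> f x = x)" for k
  \<comment> \<open>The induction starts at 5 because \<open>nbrs2_high\<close> is applied at
    \<open>4 * q + 3 - k\<close>, which must not exceed \<open>4 * q - 2\<close>.\<close>
  have five: "fixes_to 5"
    unfolding fixes_to_def
  proof (intro allI impI)
    fix x
    assume "1 \<le> x \<and> x \<le> 5 \<or> 4 * q + 2 - 5 \<le> x \<and> x \<le> 4 * q + 2"
    then have "x \<in> {1, 2, 3, 4, 5, 4 * q - 3, 4 * q - 2, 4 * q - 1, 4 * q, 4 * q + 1, 4 * q + 2}"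
      unfolding insert_iff empty_iff by presburger
    then show "f x = x" using a1 a2 a3 a4 a5 b0 b1 b2 b3 b4 b5 by auto
  qed
  have step: "fixes_to (k + 1)" if "fixes_to k" and k: "5 \<le> k" "k \<le> 2 * q" for k
  proof -
    have F: "f x = x" if "1 \<le> x \<and> x \<le> k \<or> 4 * q + 2 - k \<le> x \<and> x \<le> 4 * q + 2" for x
      using \<open>fixes_to k\<close> that unfolding fixes_to_def by blast
    \<comment> \<open>The new vertices are the partners of \<open>4 * q + 3 - k\<close> (sum
      \<open>4 * q + 4\<close>) and of \<open>k - 1\<close> (sum \<open>4 * q\<close>), whose other
      neighbours are all fixed.\<close>
    have a: "f (k + 1) = k + 1"
      by (rule fix_nbr[of "4 * q + 3 - k"]) (use q k F in \<open>auto simp: nbrs2_high\<close>)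
    have b: "f (4 * q + 1 - k) = 4 * q + 1 - k"
      by (rule fix_nbr[of "k - 1"]) (use q k F in \<open>auto simp: nbrs2_low\<close>)
    have "f x = x" if "x \<in> {k + 1, 4 * q + 1 - k}" for x
      using that a b by auto
    then show ?thesis
      unfolding fixes_to_def using F by (smt (verit) insertCI)
  qed
  have "fixes_to k" if "5 \<le> k" "k \<le> 2 * q + 1" for k
    using that by (induction k rule: int_ge_induct) (use five step in auto)
  then have "fixes_to (2 * q + 1)" using q by simp
  then show ?thesis
    using x unfolding fixes_to_def by (cases "x \<le> 2 * q + 1") auto
qed

section \<open>Degrees, the Hamiltonian cycle, and the theorem\<close>

lemma card_eq_4:
  assumes "\<And>y. P y \<longleftrightarrow> y = a \<or> y = b \<or> y = c \<or> y = d" "distinct [a, b, c, d]"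
  shows "card {y. P y} = 4"
proof -
  have "{y. P y} = set [a, b, c, d]" using assms(1) by auto
  then show ?thesis by (simp only: distinct_card[OF assms(2)]) simp
qed

lemma card_nbrs0:
  assumes q: "3 \<le> q" and x: "1 \<le> x" "x \<le> 4 * q"
  shows "card {y. adj0 q x y} = 4"
proof -
  \<comment> \<open>For \<open>q = 3\<close> the vertex \<open>3 * q\<close> falls under
    \<open>x = 4 * q - 3\<close>.\<close>
  consider "x = 1" | "2 \<le> x" "x \<le> 2 * q - 2" "x \<noteq> q" | "x = q" | "x = 2 * q - 1"
    | "2 * q \<le> x" "x \<le> 4 * q - 4" "x \<noteq> 3 * q" | "4 \<le> q" "x = 3 * q" | "x = 4 * q - 3"
    | "x = 4 * q - 2" | "x = 4 * q - 1" | "x = 4 * q"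
    using x q by linarith
  then show ?thesis
  proof cases
    case 1 then show ?thesis using q by (intro card_eq_4, simp only: nbrs0_1) auto
  next
    case 2 then show ?thesis using q by (intro card_eq_4, simp only: nbrs0_low) auto
  next
    case 3 then show ?thesis using q by (intro card_eq_4, simp only: nbrs0_q) auto
  next
    case 4 then show ?thesis using q by (intro card_eq_4, simp only: nbrs0_m1) auto
  next
    case 5 then show ?thesis using q by (intro card_eq_4, simp only: nbrs0_high) auto
  next
    case 6 then show ?thesis using q by (intro card_eq_4, simp only: nbrs0_3q) auto
  next
    case 7 show ?thesis by (rule card_eq_4, rule nbrs0_n3[OF q 7]) (use q in auto)
  next
    case 8 then show ?thesis using q by (intro card_eq_4, simp only: nbrs0_n2) auto
  next
    case 9 then show ?thesis using q by (intro card_eq_4, simp only: nbrs0_n1) auto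
  next
    case 10 then show ?thesis using q by (intro card_eq_4, simp only: nbrs0_n) auto
  qed
qed

lemma card_nbrs2:
  assumes q: "3 \<le> q" and x: "1 \<le> x" "x \<le> 4 * q + 2"
  shows "card {y. adj2 q x y} = 4"
proof -
  consider "x = 1" | "2 \<le> x" "x \<le> 2 * q - 1" | "x = 2 * q" | "x = 2 * q + 1" | "x = 2 * q + 2"
    | "2 * q + 3 \<le> x" "x \<le> 4 * q - 2" | "x = 4 * q - 1"
    | "x = 4 * q" | "x = 4 * q + 1" | "x = 4 * q + 2"
    using x q by linarith
  then show ?thesis
  proof cases
    case 1 then show ?thesis using q by (intro card_eq_4, simp only: nbrs2_1) auto
  next
    case 2 then show ?thesis using q by (intro card_eq_4, simp only: nbrs2_low) auto
  next
    case 3 then show ?thesis using q by (intro card_eq_4, simp only: nbrs2_m1) auto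
  next
    case 4 then show ?thesis using q by (intro card_eq_4, simp only: nbrs2_m) auto
  next
    case 5 then show ?thesis using q by (intro card_eq_4, simp only: nbrs2_m_plus1) auto
  next
    case 6 then show ?thesis using q by (intro card_eq_4, simp only: nbrs2_high) auto
  next
    case 7 then show ?thesis using q by (intro card_eq_4, simp only: nbrs2_n3) auto
  next
    case 8 then show ?thesis using q by (intro card_eq_4, simp only: nbrs2_n2) auto
  next
    case 9 then show ?thesis using q by (intro card_eq_4, simp only: nbrs2_n1) auto
  next
    case 10 then show ?thesis using q by (intro card_eq_4, simp only: nbrs2_n) auto
  qed
qed

section \<open>The Hamiltonian cycle\<close>

lemma pcas_successor_arcs:
  "i \<le> j \<Longrightarrow> pcas i (map (\<lambda>k. (k, k + 1)) [i..j - 1]) j"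
proof (induction "nat (j - i)" arbitrary: i)
  case 0
  then show ?case by simp
next
  case (Suc d)
  then have "i < j" by simp
  moreover have "pcas (i + 1) (map (\<lambda>k. (k, k + 1)) [i + 1..j - 1]) j"
    using Suc by (intro Suc(1)) auto
  ultimately show ?case by (simp add: upto.simps[of i])
qed

lemma pcas_append: "pcas u (p @ p') v \<longleftrightarrow> (\<exists>w. pcas u p w \<and> pcas w p' v)"
  by (induction p arbitrary: u) auto

lemma hamiltonian_if_successor_arcs:
  fixes G :: "int pair_pre_digraph"
  assumes verts: "pverts G = {1..n}" and n: "3 \<le> n"
    and arcs: "\<And>i. 1 \<le> i \<Longrightarrow> i < n \<Longrightarrow> (i, i + 1) \<in> parcs G" "(n, 1) \<in> parcs G"
  shows "hamiltonian (with_proj G)"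
proof -
  let ?p = "map (\<lambda>k. (k, k + 1)) [1..n - 1] @ [(n, 1)]"
  interpret pair_pre_digraph G .
  have tails: "map fst ?p = [1..n]"
    using n by (simp add: comp_def upto_rec2[of 1 n])
  have "cas 1 ?p 1"
    unfolding cas_with_proj_eq pcas_append using pcas_successor_arcs[of 1 n] n
    by (intro exI[of _ n] conjI) simp_all
  moreover have "distinct (tl (awalk_verts 1 ?p))"
  proof -
    have "awalk_verts 1 ?p = map fst ?p @ [1]"
      by (simp add: awalk_verts_conv)
    \<comment> \<open>\<open>1\<close> occurs at both ends of the closed walk; \<open>tl\<close>
      drops its first occurrence.\<close>
    also have "\<dots> = 1 # [2..n] @ [1]"
      unfolding tails using n by (simp add: upto_rec1[of 1 n])
    finally show ?thesis by simp
  qed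
  ultimately have "cycle ?p"
    unfolding cycle_def awalk_def using n arcs by (intro exI[of _ 1]) (auto simp: verts)
  moreover have "fst ` set ?p = pverts G"
    unfolding verts set_map[symmetric] tails by simp
  moreover have "3 \<le> length ?p" using n by simp
  ultimately show ?thesis unfolding hamiltonian_def with_proj_simps by blast
qed

section \<open>From the adjacency relation to the graph properties\<close>

lemma pair_graphI:
  assumes "finite (pverts G)" "\<And>u v. (u, v) \<in> parcs G \<Longrightarrow> u \<in> pverts G \<and> v \<in> pverts G \<and> u \<noteq> v \<and> (v, u) \<in> parcs G"
  shows "pair_graph G"
proof
  show "finite (parcs G)"
    using assms by (intro finite_subset[of "parcs G" "pverts G \<times> pverts G"]) auto
  show "symmetric (with_proj G)"
    unfolding symmetric_def by (rule symI) (use assms in simp)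
qed (use assms in auto)

lemma out_degree_with_proj:
  "out_degree (with_proj G) v = card {w. (v, w) \<in> parcs G}"
proof -
  have "out_arcs (with_proj G) v = Pair v ` {w. (v, w) \<in> parcs G}"
    by (auto simp: out_arcs_def)
  then show ?thesis by (simp add: out_degree_def card_image inj_on_def)
qed

text \<open>A permutation of the vertex set maps non-vertices to non-vertices, where
  \<open>R\<close> fails on both sides. So preservation of arcs between vertices extends to the
  whole type.\<close>

lemma asymmetricI:
  assumes ends: "\<And>u v. (u, v) \<in> parcs G \<longleftrightarrow> R u v" and range: "\<And>u v. R u v \<Longrightarrow> u \<in> pverts G \<and> v \<in> pverts G"
    and rigid: "\<And>f x. adj_automorphism R f \<Longrightarrow> x \<in> pverts G \<Longrightarrow> f x = x"
  shows "asymmetric (with_proj G)"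
proof -
  have "f = id" if f: "f permutes pverts G"
    and hom: "\<forall>u \<in> pverts G. \<forall>v \<in> pverts G. (u, v) \<in> parcs G \<longleftrightarrow> (f u, f v) \<in> parcs G" for f
  proof -
    have "adj_automorphism R f"
    proof
      show "bij f" using f by (rule permutes_bij)
      show "R (f x) (f y) \<longleftrightarrow> R x y" for x y
        using hom range[of x y] range[of "f x" "f y"] permutes_in_image[OF f] unfolding ends by metis
    qed
    then show ?thesis
      using rigid permutes_not_in[OF f] by (intro ext) (metis id_apply)
  qed
  then show ?thesis
    unfolding asymmetric_def automorphisms_def with_proj_simps using permutes_id by auto
qed

lemma Hn_properties:
  assumes n: "3 \<le> n" and ends: "\<And>u v. (u, v) \<in> parcs (Hn n) \<longleftrightarrow> R u v"
    and R: "\<And>u v. R u v \<Longrightarrow> u \<in> {1..n} \<and> v \<in> {1..n} \<and> u \<noteq> v \<and> R v u"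
    and cycle: "\<And>i. 1 \<le> i \<Longrightarrow> i < n \<Longrightarrow> R i (i + 1)" "R n 1"
    and card: "\<And>x. x \<in> {1..n} \<Longrightarrow> card {y. R x y} = 4"
    and rigid: "\<And>f x. adj_automorphism R f \<Longrightarrow> x \<in> {1..n} \<Longrightarrow> f x = x"
  shows "regular_graph 4 (with_proj (Hn n)) \<and> hamiltonian (with_proj (Hn n)) \<and>
    asymmetric (with_proj (Hn n))"
proof (intro conjI)
  have verts: "pverts (Hn n) = {1..n}" by (simp add: Hn_def Gn_def)
  interpret pair_graph "Hn n"
    by (rule pair_graphI) (use R in \<open>auto simp: verts ends\<close>)
  show "regular_graph 4 (with_proj (Hn n))"
    unfolding regular_graph_def using card
    by (simp add: pair_graphD_graph out_degree_with_proj verts ends)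
  show "hamiltonian (with_proj (Hn n))"
    using verts n cycle by (intro hamiltonian_if_successor_arcs) (auto simp: ends)
  show "asymmetric (with_proj (Hn n))"
    by (rule asymmetricI[OF ends]) (use R rigid in \<open>auto simp: verts\<close>)
qed

theorem mainTheorem4:
  fixes n :: int
  assumes "n \<ge> 12" and "even n"
  shows "regular_graph 4 (with_proj (Hn n)) \<and>
         hamiltonian (with_proj (Hn n)) \<and>
         asymmetric (with_proj (Hn n))"
proof -
  from assms(2) have "n = 4 * (n div 4) \<or> n = 4 * (n div 4) + 2" by presburger
  moreover define q where "q = n div 4"
  ultimately consider "n = 4 * q" | "n = 4 * q + 2" by blast
  then show ?thesis
  proof cases
    case 1
    with assms(1) have q: "3 \<le> q" by simp
    show ?thesis unfolding 1
    proof (rule Hn_properties[OF _ arcs_Hn0[OF q]])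
      show "u \<in> {1..4 * q} \<and> v \<in> {1..4 * q} \<and> u \<noteq> v \<and> adj0 q v u" if "adj0 q u v" for u v
        using that by (auto simp: adj0_def up0_def)
      show "adj0 q i (i + 1)" if "1 \<le> i" "i < 4 * q" for i
        using that by (simp add: adj0_def up0_def)
    qed (use q card_nbrs0 rigid0 in \<open>simp_all add: nbrs0_n\<close>)
  next
    case 2
    \<comment> \<open>\<open>12\<close> is not of the form \<open>4 * q + 2\<close>, so the bound
      \<open>n \<ge> 12\<close> again yields \<open>q \<ge> 3\<close>.\<close>
    with assms(1) have q: "3 \<le> q" by simp
    show ?thesis unfolding 2
    proof (rule Hn_properties[OF _ arcs_Hn2[OF q]])
      show "u \<in> {1..4 * q + 2} \<and> v \<in> {1..4 * q + 2} \<and> u \<noteq> v \<and> adj2 q v u" if "adj2 q u v" for u v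
        using that by (auto simp: adj2_def up2_def)
      show "adj2 q i (i + 1)" if "1 \<le> i" "i < 4 * q + 2" for i
        using that by (simp add: adj2_def up2_def)
    qed (use q card_nbrs2 rigid2 in \<open>simp_all add: nbrs2_n\<close>)
  qed
qed

end
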